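(* Assume (A1)-(A4), let $\alpha>0$ and $x_0\in\mathcal{M}(t_0)$. Suppose that there exist a local minimum trajectory $h(t)$ and a compact set $D\subset\mathbb{R}^n$ containing $x_0-h(t_0)$ such that, for every solution $x(t)$ of (P-ODE) with $x(t_0)=x_0$, the difference $x(t)-h(t)$ lies entirely in $D$ for all $t\in I_t$, where $I_t\subseteq[0,\infty)$ is a time interval with initial time $t_0$. Then (P-ODE) has a unique solution starting from $x_0$ at time $t_0$ that is defined for all $t\in I_t$.
   Context: Time-varying problem: for each $t\ge 0$, minimize $f(x,t)$ over $x\in\mathbb{R}^n$ subject to $g(x,t)=0$, where $f:\mathbb{R}^n\times[0,\infty)\to\mathbb{R}$ and $g=(g_1,\dots,g_m)$ with $g_k:\mathbb{R}^n\times[0,\infty)\to\mathbb{R}$. Write $\mathcal{J}_g(x,t)=\partial g(x,t)/\partial x\in\mathbb{R}^{m\times n}$, $g'(x,t)=\partial g(x,t)/\partial t$, and $\mathcal{M}(t)=\{x\in\mathbb{R}^n: g(x,t)=0\}$. Define $\mathcal{P}(x,t)=I_n-\mathcal{J}_g^\top(\mathcal{J}_g\mathcal{J}_g^\top)^{-1}\mathcal{J}_g$ and $\mathcal{Q}(x,t)=\mathcal{J}_g^\top(\mathcal{J}_g\mathcal{J}_g^\top)^{-1}$ (with $\mathcal{J}_g=\mathcal{J}_g(x,t)$), $\lambda(x,t)=-(\mathcal{J}_g\mathcal{J}_g^\top)^{-1}\mathcal{J}_g\nabla_x f(x,t)$, and $L(x,\lambda,t)=f(x,t)+\lambda^\top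 g(x,t)$. (P-ODE), with inertia $\alpha>0$: $\dot x(t)=-\frac1\alpha\mathcal{P}(x(t),t)\nabla_x f(x(t),t)-\mathcal{Q}(x(t),t)g'(x(t),t)$. A local minimum trajectory is a continuous map $h:I\to\mathbb{R}^n$, $I\subseteq[0,\infty)$, such that $h(t)$ is a local minimum of the problem at time $t$ for every $t\in I$. Assumptions. (A1) $f$ is twice continuously differentiable in $x$ and continuously differentiable in $t\ge0$; each $g_k$ is twice continuously differentiable in $x$ and twice continuously differentiable in $t\ge 0$; there is a constant $M$ with $f(x,t)\ge M$ for all $t\ge0$ and $x\in\mathcal{M}(t)$. (A2) $\mathcal{M}(t)\neq\emptyset$ for all $t\ge0$. (A3) $\mathcal{J}_g(x,t)$ has full row rank for all $t\ge0$ and $x\in\mathcal{M}(t)$. (A4) Each local minimum trajectory $h$ has domain $[0,\infty)$ and satisfies the second-order sufficient optimality conditions uniformly, meaning that $\nabla^2_{xx}L(h(t),\lambda,t)$ with $\lambda=\lambda(h(t),t)$ (the Hessian being taken in the first argument with $\lambda$ fixed) is positive definite on $\{y:\mathcal{J}_g(h(t),t)y=0\}$ for all $t\in[0,\infty)$. *)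

theory Defs
  imports "HOL-Analysis.Analysis"
begin

text \<open>
  Objective \<open>f :: real^'n \<Rightarrow> real \<Rightarrow> real\<close> and constraints \<open>g :: real^'n \<Rightarrow> real \<Rightarrow> real^'m\<close> take
  the state first and the time second. Only their values at times \<open>t \<ge> 0\<close> matter: the time
  derivative is taken within \<open>{0..}\<close>, so it is one-sided at \<open>0\<close>.
\<close>

definition gradient :: "('a::real_inner \<Rightarrow> real) \<Rightarrow> 'a \<Rightarrow> 'a"
  where "gradient \<phi> x = (THE D. GDERIV \<phi> x :> D)"

definition hessian :: "(real^'n \<Rightarrow> real) \<Rightarrow> real^'n \<Rightarrow> real^'n^'n"
  where "hessian \<phi> x = jacobian (gradient \<phi>) (at x)"

definition time_deriv :: "('a \<Rightarrow> real \<Rightarrow> 'b::real_normed_vector) \<Rightarrow> 'a \<Rightarrow> real \<Rightarrow> 'b"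
  where "time_deriv \<phi> x t = vector_derivative (\<phi> x) (at t within {0..})"

text \<open>
  Continuity of partial derivatives is continuity in \<open>(x, t)\<close> jointly. No mixed derivatives
  in \<open>x\<close> and \<open>t\<close> are required to exist.
\<close>

definition C2_in_x :: "(real^'n \<Rightarrow> real \<Rightarrow> real) \<Rightarrow> bool"
  where "C2_in_x \<phi> \<longleftrightarrow>
    (\<forall>t\<ge>0. \<forall>x. (\<lambda>y. \<phi> y t) differentiable (at x)) \<and>
    (\<forall>t\<ge>0. \<forall>x. gradient (\<lambda>y. \<phi> y t) differentiable (at x)) \<and>
    continuous_on (UNIV \<times> {0..}) (\<lambda>(x, t). gradient (\<lambda>y. \<phi> y t) x) \<and>
    continuous_on (UNIV \<times> {0..}) (\<lambda>(x, t). hessian (\<lambda>y. \<phi> y t) x)"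

definition C1_in_t :: "(real^'n \<Rightarrow> real \<Rightarrow> real) \<Rightarrow> bool"
  where "C1_in_t \<phi> \<longleftrightarrow>
    (\<forall>x. \<forall>t\<ge>0. \<phi> x differentiable (at t within {0..})) \<and>
    continuous_on (UNIV \<times> {0..}) (\<lambda>(x, t). time_deriv \<phi> x t)"

definition C2_in_t :: "(real^'n \<Rightarrow> real \<Rightarrow> real) \<Rightarrow> bool"
  where "C2_in_t \<phi> \<longleftrightarrow> C1_in_t \<phi> \<and> C1_in_t (time_deriv \<phi>)"

definition feasible_set :: "(real^'n \<Rightarrow> real \<Rightarrow> real^'m) \<Rightarrow> real \<Rightarrow> (real^'n) set"
  where "feasible_set g t = {x. g x t = 0}"

definition Jg :: "(real^'n \<Rightarrow> real \<Rightarrow> real^'m) \<Rightarrow> real^'n \<Rightarrow> real \<Rightarrow> real^'n^'m"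
  where "Jg g x t = jacobian (\<lambda>y. g y t) (at x)"

definition gram :: "(real^'n \<Rightarrow> real \<Rightarrow> real^'m) \<Rightarrow> real^'n \<Rightarrow> real \<Rightarrow> real^'m^'m"
  where "gram g x t = Jg g x t ** transpose (Jg g x t)"

definition proj_P :: "(real^'n \<Rightarrow> real \<Rightarrow> real^'m) \<Rightarrow> real^'n \<Rightarrow> real \<Rightarrow> real^'n^'n"
  where "proj_P g x t =
    mat 1 - transpose (Jg g x t) ** matrix_inv (gram g x t) ** Jg g x t"

definition pinv_Q :: "(real^'n \<Rightarrow> real \<Rightarrow> real^'m) \<Rightarrow> real^'n \<Rightarrow> real \<Rightarrow> real^'m^'n"
  where "pinv_Q g x t = transpose (Jg g x t) ** matrix_inv (gram g x t)"

definition multiplier ::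
    "(real^'n \<Rightarrow> real \<Rightarrow> real) \<Rightarrow> (real^'n \<Rightarrow> real \<Rightarrow> real^'m) \<Rightarrow> real^'n \<Rightarrow> real \<Rightarrow> real^'m"
  where "multiplier f g x t =
    - ((matrix_inv (gram g x t) ** Jg g x t) *v gradient (\<lambda>y. f y t) x)"

definition lagrangian ::
    "(real^'n \<Rightarrow> real \<Rightarrow> real) \<Rightarrow> (real^'n \<Rightarrow> real \<Rightarrow> real^'m) \<Rightarrow> real^'n \<Rightarrow> real^'m \<Rightarrow> real \<Rightarrow> real"
  where "lagrangian f g x l t = f x t + l \<bullet> g x t"

definition local_min ::
    "(real^'n \<Rightarrow> real \<Rightarrow> real) \<Rightarrow> (real^'n \<Rightarrow> real \<Rightarrow> real^'m) \<Rightarrow> real \<Rightarrow> real^'n \<Rightarrow> bool"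
  where "local_min f g t x \<longleftrightarrow>
    x \<in> feasible_set g t \<and>
    (\<exists>\<epsilon>>0. \<forall>y \<in> feasible_set g t \<inter> ball x \<epsilon>. f x t \<le> f y t)"

definition local_min_trajectory ::
    "(real^'n \<Rightarrow> real \<Rightarrow> real) \<Rightarrow> (real^'n \<Rightarrow> real \<Rightarrow> real^'m) \<Rightarrow>
     (real \<Rightarrow> real^'n) \<Rightarrow> real set \<Rightarrow> bool"
  where "local_min_trajectory f g h K \<longleftrightarrow>
    K \<subseteq> {0..} \<and> continuous_on K h \<and> (\<forall>t\<in>K. local_min f g t (h t))"

definition second_order_sufficient ::
    "(real^'n \<Rightarrow> real \<Rightarrow> real) \<Rightarrow> (real^'n \<Rightarrow> real \<Rightarrow> real^'m) \<Rightarrow> real^'n \<Rightarrow> real \<Rightarrow> bool"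
  where "second_order_sufficient f g x t \<longleftrightarrow>
    (let H = hessian (\<lambda>z. lagrangian f g z (multiplier f g x t) t) x
     in \<forall>y. Jg g x t *v y = 0 \<and> y \<noteq> 0 \<longrightarrow> y \<bullet> (H *v y) > 0)"

definition assumption_A1 ::
    "(real^'n \<Rightarrow> real \<Rightarrow> real) \<Rightarrow> (real^'n \<Rightarrow> real \<Rightarrow> real^'m) \<Rightarrow> bool"
  where "assumption_A1 f g \<longleftrightarrow>
    C2_in_x f \<and> C1_in_t f \<and>
    (\<forall>k. C2_in_x (\<lambda>x t. g x t $ k) \<and> C2_in_t (\<lambda>x t. g x t $ k)) \<and>
    (\<exists>M. \<forall>t\<ge>0. \<forall>x \<in> feasible_set g t. M \<le> f x t)"

definition assumption_A2 :: "(real^'n \<Rightarrow> real \<Rightarrow> real^'m) \<Rightarrow> bool"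
  where "assumption_A2 g \<longleftrightarrow> (\<forall>t\<ge>0. feasible_set g t \<noteq> {})"

definition assumption_A3 :: "(real^'n \<Rightarrow> real \<Rightarrow> real^'m) \<Rightarrow> bool"
  where "assumption_A3 g \<longleftrightarrow>
    (\<forall>t\<ge>0. \<forall>x \<in> feasible_set g t. rank (Jg g x t) = CARD('m))"

text \<open>
  Restrictions of a trajectory are again trajectories, so ``each trajectory has domain
  \<open>[0,\<infinity>)\<close>'' is understood up to continuation: every trajectory on a nondegenerate time interval
  is the restriction of a trajectory on \<open>[0,\<infinity>)\<close>.
\<close>

definition assumption_A4 ::
    "(real^'n \<Rightarrow> real \<Rightarrow> real) \<Rightarrow> (real^'n \<Rightarrow> real \<Rightarrow> real^'m) \<Rightarrow> bool"
  where "assumption_A4 f g \<longleftrightarrow>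
    (\<forall>h K. is_interval K \<and> interior K \<noteq> {} \<and> local_min_trajectory f g h K \<longrightarrow>
      (\<exists>k. local_min_trajectory f g k {0..} \<and> (\<forall>t\<in>K. k t = h t) \<and>
           (\<forall>t\<ge>0. second_order_sufficient f g (k t) t)))"

text \<open>
  \<open>matrix_inv\<close> is total, so membership of \<open>(x t, t)\<close> in the region where the right-hand side of
  the ODE is meaningful is part of being a solution.
\<close>

definition P_ODE_solution ::
    "(real^'n \<Rightarrow> real \<Rightarrow> real) \<Rightarrow> (real^'n \<Rightarrow> real \<Rightarrow> real^'m) \<Rightarrow> real \<Rightarrow>
     (real \<Rightarrow> real^'n) \<Rightarrow> real set \<Rightarrow> bool"
  where "P_ODE_solution f g \<alpha> x J \<longleftrightarrow>
    (\<forall>t\<in>J. invertible (gram g (x t) t) \<and>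
      (x has_vector_derivative
         (- (1 / \<alpha>) *\<^sub>R (proj_P g (x t) t *v gradient (\<lambda>y. f y t) (x t))
          - pinv_Q g (x t) t *v time_deriv g (x t) t)) (at t within J))"

definition time_interval_from :: "real \<Rightarrow> real set \<Rightarrow> bool"
  where "time_interval_from t0 J \<longleftrightarrow>
    is_interval J \<and> t0 \<in> J \<and> J \<subseteq> {t0..} \<and> J \<subseteq> {0..}"

end

theory Submission
  imports Defs "HOL-Complex_Analysis.Great_Picard"
begin

text \<open>
  Write the field as a tangential gradient part plus a part in the row space of \<open>Jg\<close>. Solutions
  satisfy \<open>d/dt g(x(t), t) = 0\<close>, so they stay feasible. For two solutions the difference \<open>d\<close> then
  satisfies \<open>Jg d = O(|d|^2)\<close>, which makes the inner product of \<open>d\<close> with the row-space part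
  \<open>O(|d|^2)\<close> although \<open>time_deriv g\<close> is merely continuous in \<open>x\<close>; Gronwall's inequality gives
  uniqueness. Existence on a compact interval is Peano's theorem for a bounded extension of the
  field, because solutions are confined to the compact set of feasible points in \<open>h + D\<close>, on which
  the Gram matrix is invertible.
\<close>

section \<open>Differential equations with continuous right-hand side\<close>

text \<open>Picard-Lindelof does not apply: (A1) provides no mixed derivative of \<open>g\<close> in
  state and time, so the field may fail to be Lipschitz in the state. Existence and uniqueness
  therefore need separate arguments. The irregular factor always stands behind
  \<open>transpose (Jg g x t)\<close>; moving the transpose across the inner product leaves
  \<open>Jg d\<close>, which is quadratically small by Taylor expansion of \<open>g\<close> between
  two of its zeros at the same time. Hence feasibility has to be settled before uniqueness.
  Confinement is only an a priori statement about solutions that already exist, possibly on short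
  intervals. It is applied to the initial piece on which the extended equation agrees with (P-ODE),
  and excludes a first exit there. Uniqueness serves a second time to glue the solutions on compact
  intervals when \<open>I\<close> has no last point.\<close>

lemma vector_derivative_bound_Lipschitz:
  fixes z :: "real \<Rightarrow> 'a::real_normed_vector"
  assumes der: "\<And>t. t \<in> {a..b} \<Longrightarrow> (z has_vector_derivative z' t) (at t within {a..b})"
    and bound: "\<And>t. t \<in> {a..b} \<Longrightarrow> norm (z' t) \<le> B"
    and "s \<in> {a..b}" "t \<in> {a..b}"
  shows "norm (z s - z t) \<le> B * \<bar>s - t\<bar>"
proof -
  have "norm (z s - z t) \<le> B * norm (s - t)"
  proof (rule differentiable_bound[where S = "{a..b}" and f' = "\<lambda>t h. h *\<^sub>R z' t"])
    show "onorm (\<lambda>h. h *\<^sub>R z' t) \<le> B" if "t \<in> {a..b}" for t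
    proof (rule onorm_le)
      fix h :: real
      show "norm (h *\<^sub>R z' t) \<le> B * norm h"
        using mult_left_mono[OF bound[OF that], of "\<bar>h\<bar>"] by (simp add: mult.commute)
    qed
  qed (use assms in \<open>auto simp: has_vector_derivative_def\<close>)
  then show ?thesis by simp
qed

text \<open>
  Tonelli's delayed equation. Iterating the delayed integral operator \<open>k\<close> times fixes the solution
  on \<open>[a, a + k \<delta>]\<close>, so finitely many iterations suffice.
\<close>

lemma delayed_ODE_solution:
  fixes F :: "'a::euclidean_space \<times> real \<Rightarrow> 'a"
  assumes F: "continuous_on (UNIV \<times> {a..b}) F" and "0 < \<delta>"
  obtains z where "continuous_on {a..b} z"
    and "\<And>t. t \<in> {a..b} \<Longrightarrow> z t = x0 + integral {a..t} (\<lambda>s. F (z (max a (s - \<delta>)), s))"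
proof -
  \<comment> \<open>For \<open>s\<close> below \<open>a + \<delta>\<close> the delayed argument is
    clamped to \<open>a\<close>, where every iterate equals \<open>x0\<close>; no prehistory has to
    be prescribed.\<close>
  define G where "G w t = x0 + integral {a..t} (\<lambda>s. F (w (max a (s - \<delta>)), s))" for w t
  define Z where "Z k = (G ^^ k) (\<lambda>_. x0)" for k
  have Z_Suc: "Z (Suc k) = G (Z k)" for k
    by (simp add: Z_def)
  have G_cont: "continuous_on {a..b} (G w)" if "continuous_on {a..b} w" for w
  proof -
    have "continuous_on {a..b} (\<lambda>s. F (w (max a (s - \<delta>)), s))"
      by (rule continuous_on_compose2[OF F])
        (use \<open>0 < \<delta>\<close> in \<open>auto intro!: continuous_intros continuous_on_compose2[OF that]\<close>)
    then have "continuous_on {a..b} (\<lambda>t. integral {a..t} (\<lambda>s. F (w (max a (s - \<delta>)), s)))"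
      by (intro indefinite_integral_continuous_1 integrable_continuous_real)
    then show ?thesis
      unfolding G_def by (intro continuous_intros)
  qed
  have Z_cont: "continuous_on {a..b} (Z k)" for k
    by (induction k) (auto simp: Z_Suc G_cont, simp add: Z_def)
  have Z_fix: "Z (Suc k) t = Z k t" if "t \<in> {a..b}" "t \<le> a + real k * \<delta>" for k t
    using that
  proof (induction k arbitrary: t)
    case 0
    then have "t = a" by auto
    then show ?case by (simp add: Z_def G_def)
  next
    case (Suc k)
    \<comment> \<open>Up to time \<open>t\<close> the integrand looks back only to
      \<open>t - \<delta>\<close>, so each iteration gains one \<delta> of agreement.\<close>
    have "Z (Suc k) (max a (s - \<delta>)) = Z k (max a (s - \<delta>))" if "s \<in> {a..t}" for s
      using that Suc.prems \<open>0 < \<delta>\<close> by (intro Suc.IH) (auto simp: algebra_simps)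
    then have "integral {a..t} (\<lambda>s. F (Z (Suc k) (max a (s - \<delta>)), s)) =
        integral {a..t} (\<lambda>s. F (Z k (max a (s - \<delta>)), s))"
      by (intro integral_cong) auto
    then show ?case
      by (simp add: Z_Suc[of "Suc k"] Z_Suc[of k] G_def)
  qed
  obtain N :: nat where "(b - a) / \<delta> \<le> real N"
    using real_arch_simple by blast
  then have N: "b \<le> a + real N * \<delta>"
    using \<open>0 < \<delta>\<close> by (simp add: field_simps)
  show thesis
  proof (rule that[OF Z_cont])
    show "Z N t = x0 + integral {a..t} (\<lambda>s. F (Z N (max a (s - \<delta>)), s))" if "t \<in> {a..b}" for t
      using Z_fix[OF that, of N] N that by (simp add: Z_Suc G_def)
  qed
qed

text \<open>The delayed solutions share the Lipschitz constant \<open>B\<close>, so Arzela-Ascoli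
  gives a uniformly convergent subsequence, and the delay changes their values by at most
  \<open>B * \<delta> n\<close>. As \<open>B\<close> bounds \<open>F\<close> for all states, the
  interval need not shrink.\<close>

lemma Peano_existence:
  fixes F :: "'a::euclidean_space \<times> real \<Rightarrow> 'a"
  assumes F: "continuous_on (UNIV \<times> {a..b}) F"
    and bound: "\<And>x t. t \<in> {a..b} \<Longrightarrow> norm (F (x, t)) \<le> B"
    and "a \<le> b"
  obtains x where "x a = x0"
    and "\<And>t. t \<in> {a..b} \<Longrightarrow> (x has_vector_derivative F (x t, t)) (at t within {a..b})"
proof -
  define \<delta> where "\<delta> n = inverse (real (Suc n))" for n
  have \<delta>: "\<delta> n > 0" for n
    by (simp add: \<delta>_def)
  have "0 \<le> B"
    using bound[of a] \<open>a \<le> b\<close> norm_ge_zero order_trans by (metis atLeastAtMost_iff order_refl)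
  have "\<exists>z. continuous_on {a..b} z \<and>
      (\<forall>t\<in>{a..b}. z t = x0 + integral {a..t} (\<lambda>s. F (z (max a (s - \<delta> n)), s)))" for n
    using delayed_ODE_solution[OF F \<delta>[of n]] by metis
  then obtain z where z_cont: "\<And>n. continuous_on {a..b} (z n)"
    and z: "\<And>n t. t \<in> {a..b} \<Longrightarrow> z n t = x0 + integral {a..t} (\<lambda>s. F (z n (max a (s - \<delta> n)), s))"
    by metis
  have delay: "max a (s - \<delta> n) \<in> {a..b}" if "s \<in> {a..b}" for s n
    using that \<delta>[of n] by auto
  have rhs_cont: "continuous_on {a..b} (\<lambda>s. F (z n (max a (s - \<delta> n)), s))" for n
    by (rule continuous_on_compose2[OF F])
      (use delay in \<open>auto intro!: continuous_intros continuous_on_compose2[OF z_cont]\<close>)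
  have z_deriv: "(z n has_vector_derivative F (z n (max a (t - \<delta> n)), t)) (at t within {a..b})"
    if "t \<in> {a..b}" for n t
  proof -
    have "((\<lambda>t. x0 + integral {a..t} (\<lambda>s. F (z n (max a (s - \<delta> n)), s)))
        has_vector_derivative F (z n (max a (t - \<delta> n)), t)) (at t within {a..b})"
      using integral_has_vector_derivative[OF rhs_cont that]
      by (auto intro!: derivative_eq_intros)
    then show ?thesis
      by (rule has_vector_derivative_transform[OF that, rotated]) (simp add: z)
  qed
  have Lip: "norm (z n s - z n t) \<le> B * \<bar>s - t\<bar>" if "s \<in> {a..b}" "t \<in> {a..b}" for n s t
    by (rule vector_derivative_bound_Lipschitz[OF z_deriv]) (use that bound in auto)
  have z_a: "z n a = x0" for n
    using z[of a n] \<open>a \<le> b\<close> by simp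
  have z_bound: "norm (z n t) \<le> norm x0 + B * (b - a)" if "t \<in> {a..b}" for n t
  proof -
    have "norm (z n t - x0) \<le> B * (b - a)"
      using Lip[of t a n] that z_a \<open>0 \<le> B\<close> mult_left_mono[of "t - a" "b - a" B] by auto
    then show ?thesis
      using norm_triangle_sub[of "z n t" x0] by linarith
  qed
  have equi: "\<exists>d>0. \<forall>n y. y \<in> {a..b} \<and> norm (x - y) < d \<longrightarrow> norm (z n x - z n y) < e"
    if "x \<in> {a..b}" "0 < e" for x e
  proof (intro exI conjI allI impI)
    show "0 < e / (B + 1)" using \<open>0 \<le> B\<close> that by simp
    fix n y assume y: "y \<in> {a..b} \<and> norm (x - y) < e / (B + 1)"
    have "norm (z n x - z n y) \<le> B * \<bar>x - y\<bar>"
      using Lip that y by blast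
    also have "\<dots> \<le> (B + 1) * \<bar>x - y\<bar>"
      by (simp add: mult_right_mono)
    also have "\<dots> < e"
      using y \<open>0 \<le> B\<close> by (simp add: field_simps)
    finally show "norm (z n x - z n y) < e" .
  qed
  obtain x k where x_cont: "continuous_on {a..b} x" and k: "strict_mono (k :: nat \<Rightarrow> nat)"
    and conv: "\<And>e. 0 < e \<Longrightarrow> \<exists>N. \<forall>n t. n \<ge> N \<and> t \<in> {a..b} \<longrightarrow> norm (z (k n) t - x t) < e"
    using Arzela_Ascoli[of "{a..b}" z, OF _ z_bound equi] by blast
  have z_lim: "(\<lambda>n. z (k n) t) \<longlonglongrightarrow> x t" if "t \<in> {a..b}" for t
    unfolding LIMSEQ_iff using conv that by blast
  have \<delta>_lim: "(\<lambda>n. \<delta> (k n)) \<longlonglongrightarrow> 0"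
    using LIMSEQ_subseq_LIMSEQ[OF LIMSEQ_inverse_real_of_nat k] by (simp add: \<delta>_def o_def)
  have delay_lim: "(\<lambda>n. z (k n) (max a (s - \<delta> (k n)))) \<longlonglongrightarrow> x s" if s: "s \<in> {a..b}" for s
  proof (rule Lim_transform[OF z_lim[OF s]])
    show "(\<lambda>n. z (k n) (max a (s - \<delta> (k n))) - z (k n) s) \<longlonglongrightarrow> 0"
    proof (rule Lim_null_comparison)
      have "norm (z (k n) (max a (s - \<delta> (k n))) - z (k n) s) \<le> B * \<delta> (k n)" for n
      proof -
        have "\<bar>max a (s - \<delta> (k n)) - s\<bar> \<le> \<delta> (k n)"
          using s \<delta>[of "k n"] by auto
        then show ?thesis
          using Lip[OF delay[OF s] s, of "k n" "k n"] \<open>0 \<le> B\<close>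
          by (meson mult_left_mono order_trans)
      qed
      then show "\<forall>\<^sub>F n in sequentially.
          norm (z (k n) (max a (s - \<delta> (k n))) - z (k n) s) \<le> B * \<delta> (k n)"
        by simp
      show "(\<lambda>n. B * \<delta> (k n)) \<longlonglongrightarrow> 0"
        using tendsto_mult_left[OF \<delta>_lim, of B] by simp
    qed
  qed
  \<comment> \<open>The limit is taken in the integral equation: derivatives need not converge, but
    the integrands do, pointwise and dominated by \<open>B\<close>.\<close>
  have x_eq: "x t = x0 + integral {a..t} (\<lambda>s. F (x s, s))" if t: "t \<in> {a..b}" for t
  proof -
    have "(\<lambda>n. integral {a..t} (\<lambda>s. F (z (k n) (max a (s - \<delta> (k n))), s)))
        \<longlonglongrightarrow> integral {a..t} (\<lambda>s. F (x s, s))"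
    proof (rule dominated_convergence(2)[where h = "\<lambda>_. B"])
      show "(\<lambda>s. F (z (k n) (max a (s - \<delta> (k n))), s)) integrable_on {a..t}" for n
        using t by (intro integrable_continuous_real continuous_on_subset[OF rhs_cont]) auto
      show "norm (F (z (k n) (max a (s - \<delta> (k n))), s)) \<le> B" if "s \<in> {a..t}" for n s
        using that t by (intro bound) auto
      show "(\<lambda>n. F (z (k n) (max a (s - \<delta> (k n))), s)) \<longlonglongrightarrow> F (x s, s)" if "s \<in> {a..t}" for s
        by (rule continuous_on_tendsto_compose[OF F])
          (use that t delay_lim[of s] in \<open>auto intro!: tendsto_intros\<close>)
    qed auto
    then have "(\<lambda>n. z (k n) t) \<longlonglongrightarrow> x0 + integral {a..t} (\<lambda>s. F (x s, s))"
      unfolding z[OF t] by (intro tendsto_intros)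
    then show ?thesis
      using z_lim[OF t] LIMSEQ_unique by blast
  qed
  have "continuous_on {a..b} (\<lambda>s. F (x s, s))"
    by (rule continuous_on_compose2[OF F]) (auto intro!: continuous_intros x_cont)
  then have "((\<lambda>t. x0 + integral {a..t} (\<lambda>s. F (x s, s))) has_vector_derivative F (x t, t))
      (at t within {a..b})" if "t \<in> {a..b}" for t
    using integral_has_vector_derivative[OF _ that] by (auto intro!: derivative_eq_intros)
  then have "(x has_vector_derivative F (x t, t)) (at t within {a..b})" if "t \<in> {a..b}" for t
    using x_eq that has_vector_derivative_transform by (metis (no_types, lifting))
  moreover have "x a = x0"
    using x_eq[of a] \<open>a \<le> b\<close> by simp
  ultimately show thesis
    using that by blast
qed

text \<open>The factor \<open>exp (- C * s)\<close> turns the differential inequality into monotone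
  decrease. Applied to the squared distance of two solutions, it forces them to coincide.\<close>

lemma Gronwall_nonpos:
  fixes \<phi> :: "real \<Rightarrow> real"
  assumes der: "\<And>t. t \<in> {a..b} \<Longrightarrow> (\<phi> has_vector_derivative \<phi>' t) (at t within {a..b})"
    and le: "\<And>t. t \<in> {a..b} \<Longrightarrow> \<phi>' t \<le> C * \<phi> t"
    and "\<phi> a \<le> 0" and t: "t \<in> {a..b}"
  shows "\<phi> t \<le> 0"
proof (cases "t = a")
  case False
  define \<psi> where "\<psi> s = exp (- C * s) * \<phi> s" for s
  have \<psi>: "(\<psi> has_derivative (\<lambda>h. h * (exp (- C * s) * (\<phi>' s - C * \<phi> s)))) (at s within {a..t})"
    if "a \<le> s" "s \<le> t" for s
  proof -
    have "(\<phi> has_derivative (\<lambda>h. h * \<phi>' s)) (at s within {a..t})"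
      using der[of s] that t
      by (auto simp: has_vector_derivative_def intro: has_derivative_subset)
    then show ?thesis
      unfolding \<psi>_def by (auto intro!: derivative_eq_intros simp: algebra_simps)
  qed
  obtain s where s: "s \<in> {a<..<t}"
    and eq: "\<psi> t - \<psi> a = (t - a) * (exp (- C * s) * (\<phi>' s - C * \<phi> s))"
    using mvt_simple[OF _ \<psi>] False t by auto
  have "(t - a) * (exp (- C * s) * (\<phi>' s - C * \<phi> s)) \<le> 0"
    using le[of s] s t by (auto intro!: mult_nonneg_nonpos)
  with eq have "\<psi> t \<le> \<psi> a" by simp
  also have "\<dots> \<le> 0"
    using \<open>\<phi> a \<le> 0\<close> by (simp add: \<psi>_def mult_nonneg_nonpos)
  finally show ?thesis
    by (simp add: \<psi>_def mult_le_0_iff)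
qed (use assms in simp)

section \<open>Gradients, Jacobians and time derivatives\<close>

text \<open>\<open>gradient\<close> is a definite description: the Riesz representative of the
  derivative gives existence, uniqueness of derivatives the rest.\<close>

lemma gradient_works:
  fixes \<phi> :: "'a::euclidean_space \<Rightarrow> real"
  assumes "\<phi> differentiable (at x)"
  shows "(\<phi> has_derivative (\<lambda>h. h \<bullet> gradient \<phi> x)) (at x)"
proof -
  obtain \<phi>' where \<phi>': "(\<phi> has_derivative \<phi>') (at x)"
    using assms by (auto simp: differentiable_def)
  interpret bounded_linear \<phi>'
    by (rule has_derivative_bounded_linear[OF \<phi>'])
  have "\<phi>' = (\<lambda>h. h \<bullet> (\<Sum>b\<in>Basis. \<phi>' b *\<^sub>R b))"
  proof
    fix h
    have "\<phi>' h = \<phi>' (\<Sum>b\<in>Basis. (h \<bullet> b) *\<^sub>R b)"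
      by (simp add: euclidean_representation)
    also have "\<dots> = h \<bullet> (\<Sum>b\<in>Basis. \<phi>' b *\<^sub>R b)"
      by (simp add: sum scaleR inner_sum_right mult.commute)
    finally show "\<phi>' h = h \<bullet> (\<Sum>b\<in>Basis. \<phi>' b *\<^sub>R b)" .
  qed
  with \<phi>' have ex: "GDERIV \<phi> x :> (\<Sum>b\<in>Basis. \<phi>' b *\<^sub>R b)"
    by (simp add: gderiv_def)
  have "GDERIV \<phi> x :> gradient \<phi> x"
    unfolding gradient_def
  proof (rule theI[where P = "\<lambda>D. GDERIV \<phi> x :> D", OF ex])
    fix D assume "GDERIV \<phi> x :> D"
    then have "(\<lambda>h. h \<bullet> D) = (\<lambda>h. h \<bullet> (\<Sum>b\<in>Basis. \<phi>' b *\<^sub>R b))"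
      using ex unfolding gderiv_def by (rule has_derivative_unique)
    then show "D = (\<Sum>b\<in>Basis. \<phi>' b *\<^sub>R b)"
      by (metis vector_eq_ldot)
  qed
  then show ?thesis
    by (simp add: gderiv_def)
qed

lemma has_derivative_vec_nth_iff:
  fixes F :: "'a::real_normed_vector \<Rightarrow> real^'m"
  shows "(F has_derivative F') (at x within S) \<longleftrightarrow>
    (\<forall>k. ((\<lambda>y. F y $ k) has_derivative (\<lambda>h. F' h $ k)) (at x within S))"
  by (subst has_derivative_componentwise_within) (auto simp: Basis_vec_def inner_axis)

lemma
  assumes "\<And>k. (\<lambda>y. g y t $ k) differentiable (at x)"
  shows Jg_works: "((\<lambda>y. g y t) has_derivative (\<lambda>h. Jg g x t *v h)) (at x)"
    and Jg_row: "Jg g x t $ k = gradient (\<lambda>y. g y t $ k) x"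
proof -
  define G where "G = (\<chi> k. gradient (\<lambda>y. g y t $ k) x)"
  have der: "((\<lambda>y. g y t) has_derivative (\<lambda>h. G *v h)) (at x)"
    unfolding has_derivative_vec_nth_iff
    using gradient_works[OF assms]
    by (simp add: G_def matrix_mult_dot inner_commute)
  then show *: "((\<lambda>y. g y t) has_derivative (\<lambda>h. Jg g x t *v h)) (at x)"
    unfolding Jg_def using jacobian_works[of "\<lambda>y. g y t" "at x"] by (auto simp: differentiable_def)
  have "(\<lambda>h. Jg g x t *v h) = (\<lambda>h. G *v h)"
    using * der by (rule has_derivative_unique)
  then have "Jg g x t = G"
    by (metis matrix_of_matrix_vector_mul)
  then show "Jg g x t $ k = gradient (\<lambda>y. g y t $ k) x"
    by (simp add: G_def)
qed

lemma
  fixes g :: "'a \<Rightarrow> real \<Rightarrow> real^'m"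
  assumes diff: "\<And>k. (\<lambda>s. g x s $ k) differentiable (at t within {0..})" and "0 \<le> t"
  shows time_deriv_works: "(g x has_vector_derivative time_deriv g x t) (at t within {0..})"
    and time_deriv_component: "time_deriv g x t $ k = time_deriv (\<lambda>x t. g x t $ k) x t"
proof -
  \<comment> \<open>A derivative within \<open>{0..}\<close> is unique only along a nontrivial
    filter; right neighbourhoods provide this even at time 0.\<close>
  have nontriv: "at t within {0..} \<noteq> bot"
  proof -
    have "{t<..} \<subseteq> {0..}"
      using \<open>0 \<le> t\<close> by auto
    then have "at_right t \<le> at t within {0..}"
      by (rule at_le)
    then show ?thesis
      using trivial_limit_at_right_real[of t] by (auto simp: bot_unique)
  qed
  define D where "D = (\<chi> k. time_deriv (\<lambda>x t. g x t $ k) x t)"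
  have "((\<lambda>s. g x s $ k) has_vector_derivative D $ k) (at t within {0..})" for k
    using diff[of k] by (simp add: D_def time_deriv_def vector_derivative_works)
  then have *: "(g x has_vector_derivative D) (at t within {0..})"
    unfolding has_vector_derivative_def by (subst has_derivative_vec_nth_iff) simp
  then have "time_deriv g x t = D"
    unfolding time_deriv_def using nontriv by (intro vector_derivative_within) auto
  with * show "(g x has_vector_derivative time_deriv g x t) (at t within {0..})"
    and "time_deriv g x t $ k = time_deriv (\<lambda>x t. g x t $ k) x t"
    by (simp_all add: D_def)
qed

text \<open>Joint continuity bounds the Hessian on a compact set of states and times; the mean value
  inequality on the convex ball then yields one constant for all times.\<close>

lemma C2_gradient_Lipschitz:
  fixes \<phi> :: "real^'n \<Rightarrow> real \<Rightarrow> real"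
  assumes "C2_in_x \<phi>" and "0 \<le> a"
  obtains L where "L \<ge> 0" and "\<And>x y t. \<lbrakk>x \<in> cball 0 R; y \<in> cball 0 R; t \<in> {a..b}\<rbrakk> \<Longrightarrow>
    norm (gradient (\<lambda>z. \<phi> z t) x - gradient (\<lambda>z. \<phi> z t) y) \<le> L * norm (x - y)"
proof -
  have "continuous_on (cball 0 R \<times> {a..b}) (\<lambda>(x, t). hessian (\<lambda>y. \<phi> y t) x)"
    by (rule continuous_on_subset[of "UNIV \<times> {0..}"]) (use assms in \<open>auto simp: C2_in_x_def\<close>)
  then have "bounded ((\<lambda>(x, t). hessian (\<lambda>y. \<phi> y t) x) ` (cball 0 R \<times> {a..b}))"
    by (intro compact_imp_bounded compact_continuous_image compact_Times) auto
  then obtain M where "M > 0"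
    and M: "\<And>p. p \<in> cball 0 R \<times> {a..b} \<Longrightarrow>
      norm ((\<lambda>(x, t). hessian (\<lambda>y. \<phi> y t) x) p) \<le> M"
    unfolding bounded_pos by blast
  \<comment> \<open>An entrywise bound \<open>M\<close> controls the operator norm up to the number
    of entries.\<close>
  define L where "L = real CARD('n) * real CARD('n) * M"
  show thesis
  proof (rule that[of L])
    show "L \<ge> 0" using \<open>M > 0\<close> by (simp add: L_def)
    fix x y :: "real^'n" and t assume *: "x \<in> cball 0 R" "y \<in> cball 0 R" "t \<in> {a..b}"
    show "norm (gradient (\<lambda>z. \<phi> z t) x - gradient (\<lambda>z. \<phi> z t) y) \<le> L * norm (x - y)"
    proof (rule differentiable_bound[where S = "cball 0 R"
          and f' = "\<lambda>x h. hessian (\<lambda>y. \<phi> y t) x *v h"])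
      fix z :: "real^'n" assume z: "z \<in> cball 0 R"
      have "gradient (\<lambda>z. \<phi> z t) differentiable (at z)"
        using assms * by (simp add: C2_in_x_def)
      then show "(gradient (\<lambda>z. \<phi> z t) has_derivative (\<lambda>h. hessian (\<lambda>y. \<phi> y t) z *v h))
          (at z within cball 0 R)"
        unfolding hessian_def jacobian_works by (rule has_derivative_at_withinI)
      show "onorm (\<lambda>h. hessian (\<lambda>y. \<phi> y t) z *v h) \<le> L"
        unfolding L_def
      proof (rule onorm_le_matrix_component)
        fix i j
        have "\<bar>hessian (\<lambda>y. \<phi> y t) z $ i $ j\<bar> \<le> norm (hessian (\<lambda>y. \<phi> y t) z)"
          using component_le_norm_cart[of "hessian (\<lambda>y. \<phi> y t) z $ i" j]
            Finite_Cartesian_Product.norm_nth_le[of "hessian (\<lambda>y. \<phi> y t) z" i] by linarith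
        also have "\<dots> \<le> M"
          using M[of "(z, t)"] z * by simp
        finally show "\<bar>hessian (\<lambda>y. \<phi> y t) z $ i $ j\<bar> \<le> M" .
      qed
    qed (use * in auto)
  qed
qed

text \<open>Subtracting the linear part frozen at \<open>x\<close> leaves a function whose gradient
  on the segment is at most \<open>L * norm (y - x)\<close>; the mean value inequality supplies the
  second factor. The sharp constant 1/2 is given up.\<close>

lemma C2_Taylor_bound:
  fixes \<phi> :: "real^'n \<Rightarrow> real \<Rightarrow> real"
  assumes C2: "C2_in_x \<phi>" and "0 \<le> a"
  obtains L where "L \<ge> 0" and "\<And>x y t. \<lbrakk>x \<in> cball 0 R; y \<in> cball 0 R; t \<in> {a..b}\<rbrakk> \<Longrightarrow>
    \<bar>\<phi> y t - \<phi> x t - (y - x) \<bullet> gradient (\<lambda>z. \<phi> z t) x\<bar> \<le> L * (norm (y - x))\<^sup>2"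
proof -
  obtain L where "L \<ge> 0" and L: "\<And>x y t. \<lbrakk>x \<in> cball 0 R; y \<in> cball 0 R; t \<in> {a..b}\<rbrakk> \<Longrightarrow>
    norm (gradient (\<lambda>z. \<phi> z t) x - gradient (\<lambda>z. \<phi> z t) y) \<le> L * norm (x - y)"
    using C2_gradient_Lipschitz[OF assms] by blast
  show thesis
  proof (rule that[OF \<open>L \<ge> 0\<close>])
    fix x y :: "real^'n" and t assume *: "x \<in> cball 0 R" "y \<in> cball 0 R" "t \<in> {a..b}"
    let ?G = "\<lambda>z. gradient (\<lambda>z. \<phi> z t) z"
    let ?\<psi> = "\<lambda>z. \<phi> z t - z \<bullet> ?G x"
    have "norm (?\<psi> y - ?\<psi> x) \<le> L * norm (y - x) * norm (y - x)"
    proof (rule differentiable_bound[where S = "closed_segment x y"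
          and f' = "\<lambda>z h. h \<bullet> ?G z - h \<bullet> ?G x"])
      fix z assume z: "z \<in> closed_segment x y"
      then have zR: "z \<in> cball 0 R"
        using * closed_segment_subset[of x "cball 0 R" y] by (auto simp: convex_cball)
      have "((\<lambda>z. \<phi> z t) has_derivative (\<lambda>h. h \<bullet> ?G z)) (at z)"
        using C2 * \<open>0 \<le> a\<close> by (intro gradient_works) (simp add: C2_in_x_def)
      then show "(?\<psi> has_derivative (\<lambda>h. h \<bullet> ?G z - h \<bullet> ?G x)) (at z within closed_segment x y)"
        by (auto intro!: derivative_eq_intros intro: has_derivative_at_withinI)
      show "onorm (\<lambda>h. h \<bullet> ?G z - h \<bullet> ?G x) \<le> L * norm (y - x)"
      proof (rule onorm_le)
        fix h
        have "\<bar>h \<bullet> (?G z - ?G x)\<bar> \<le> norm h * norm (?G z - ?G x)"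
          by (rule Cauchy_Schwarz_ineq2)
        also have "\<dots> \<le> norm h * (L * norm (z - x))"
          using L[OF zR] * by (intro mult_left_mono) auto
        also have "\<dots> \<le> norm h * (L * norm (y - x))"
          using segment_bound[OF z] \<open>L \<ge> 0\<close> by (intro mult_left_mono) auto
        finally show "norm (h \<bullet> ?G z - h \<bullet> ?G x) \<le> L * norm (y - x) * norm h"
          by (simp add: inner_diff_right mult_ac)
      qed
    qed auto
    then show "\<bar>\<phi> y t - \<phi> x t - (y - x) \<bullet> ?G x\<bar> \<le> L * (norm (y - x))\<^sup>2"
      by (simp add: inner_diff_left power2_eq_square algebra_simps)
  qed
qed

section \<open>Continuity of matrix operations\<close>

lemma continuous_on_matrix_vector_mult:
  fixes A :: "'a::topological_space \<Rightarrow> real^'n^'m"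
  assumes "continuous_on S A" "continuous_on S b"
  shows "continuous_on S (\<lambda>p. A p *v b p)"
  unfolding matrix_vector_mult_def using assms by (intro continuous_intros)

lemma continuous_on_matrix_mult:
  fixes A :: "'a::topological_space \<Rightarrow> real^'n^'m" and B :: "'a \<Rightarrow> real^'k^'n"
  assumes "continuous_on S A" "continuous_on S B"
  shows "continuous_on S (\<lambda>p. A p ** B p)"
  unfolding matrix_matrix_mult_def using assms by (intro continuous_intros)

lemma continuous_on_transpose:
  fixes A :: "'a::topological_space \<Rightarrow> real^'n^'m"
  assumes "continuous_on S A"
  shows "continuous_on S (\<lambda>p. transpose (A p))"
  unfolding transpose_def using assms by (intro continuous_intros)

lemma continuous_on_det:
  fixes A :: "'a::topological_space \<Rightarrow> real^'n^'n"
  assumes "continuous_on S A"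
  shows "continuous_on S (\<lambda>p. det (A p))"
  unfolding det_def using assms by (intro continuous_intros)

lemma matrix_inv_right:
  fixes A :: "real^'n^'n"
  assumes "invertible A"
  shows "A ** matrix_inv A = mat 1"
  using someI_ex[OF assms[unfolded invertible_def]] by (simp add: matrix_inv_def)

text \<open>Cramer's rule expresses the components as quotients of determinants, which inherit
  continuity from the entries.\<close>

lemma continuous_on_matrix_inv_mult:
  fixes A :: "'a::topological_space \<Rightarrow> real^'n^'n"
  assumes A: "continuous_on S A" and b: "continuous_on S b"
    and inv: "\<And>p. p \<in> S \<Longrightarrow> invertible (A p)"
  shows "continuous_on S (\<lambda>p. matrix_inv (A p) *v b p)"
proof -
  have "continuous_on S (\<lambda>p. \<chi> k. det (\<chi> i j. if j = k then b p $ i else A p $ i $ j) / det (A p))"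
  proof (intro continuous_on_vec_lambda continuous_on_divide continuous_on_det A ballI)
    show "continuous_on S (\<lambda>p. if j = k then b p $ i else A p $ i $ j)" for i j k
      using A b by (cases "j = k") (auto intro!: continuous_intros)
    show "det (A p) \<noteq> 0" if "p \<in> S" for p
      using inv[OF that] by (simp add: invertible_det_nz)
  qed
  also have "?this \<longleftrightarrow> ?thesis"
  proof (rule continuous_on_cong[OF refl])
    fix p assume "p \<in> S"
    have "A p *v (matrix_inv (A p) *v b p) = b p"
      by (simp add: matrix_vector_mul_assoc matrix_inv_right inv \<open>p \<in> S\<close>)
    then show "(\<chi> k. det (\<chi> i j. if j = k then b p $ i else A p $ i $ j) / det (A p)) =
        matrix_inv (A p) *v b p"
      using cramer[of "A p"] inv[OF \<open>p \<in> S\<close>] by (simp add: invertible_det_nz)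
  qed
  finally show ?thesis .
qed

text \<open>Full row rank makes the transpose J^T injective, and y . (J J^T y) = |J^T y|^2 passes
  this on to the Gram matrix.\<close>

lemma full_rank_gram_invertible:
  fixes g :: "real^'n \<Rightarrow> real \<Rightarrow> real^'m"
  assumes "rank (Jg g x t) = CARD('m)"
  shows "invertible (gram g x t)"
proof -
  let ?J = "Jg g x t"
  have inj: "inj ((*v) (transpose ?J))"
    using assms by (simp flip: full_rank_injective add: rank_transpose)
  have "inj ((*v) (gram g x t))"
  proof (rule injI)
    fix y z assume "gram g x t *v y = gram g x t *v z"
    then have "gram g x t *v (y - z) = 0"
      by (simp add: matrix_vector_mult_diff_distrib)
    then have "(y - z) \<bullet> (?J *v (transpose ?J *v (y - z))) = 0"
      by (simp only: gram_def matrix_vector_mul_assoc inner_zero_right)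
    then have "(transpose ?J *v (y - z)) \<bullet> (transpose ?J *v (y - z)) = 0"
      by (metis dot_lmul_matrix transpose_matrix_vector)
    then have "transpose ?J *v y = transpose ?J *v z"
      by (simp add: matrix_vector_mult_diff_distrib)
    then show "y = z"
      by (rule injD[OF inj])
  qed
  then show ?thesis
    using invertible_left_inverse matrix_left_invertible_injective by blast
qed

section \<open>The projected gradient field\<close>

definition P_field ::
    "(real^'n \<Rightarrow> real \<Rightarrow> real) \<Rightarrow> (real^'n \<Rightarrow> real \<Rightarrow> real^'m) \<Rightarrow> real \<Rightarrow>
     real^'n \<Rightarrow> real \<Rightarrow> real^'n"
  where "P_field f g \<alpha> x t =
    - (1 / \<alpha>) *\<^sub>R (proj_P g x t *v gradient (\<lambda>y. f y t) x) - pinv_Q g x t *v time_deriv g x t"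

text \<open>The multiplier \<open>multiplier f g x t\<close> divided by \<alpha>, plus the
  correction for the moving constraint. Merging them collects every occurrence of the inverse Gram
  matrix behind a single \<open>transpose (Jg g x t)\<close>.\<close>

definition normal_coeff ::
    "(real^'n \<Rightarrow> real \<Rightarrow> real) \<Rightarrow> (real^'n \<Rightarrow> real \<Rightarrow> real^'m) \<Rightarrow> real \<Rightarrow>
     real^'n \<Rightarrow> real \<Rightarrow> real^'m"
  where "normal_coeff f g \<alpha> x t = matrix_inv (gram g x t) *v
    (time_deriv g x t - (1 / \<alpha>) *\<^sub>R (Jg g x t *v gradient (\<lambda>y. f y t) x))"

lemma P_field_eq:
  "P_field f g \<alpha> x t = - (1 / \<alpha>) *\<^sub>R gradient (\<lambda>y. f y t) x
    - transpose (Jg g x t) *v normal_coeff f g \<alpha> x t"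
  by (simp add: P_field_def normal_coeff_def proj_P_def pinv_Q_def
      matrix_vector_mult_diff_distrib matrix_vector_mult_diff_rdistrib matrix_vector_mult_scaleR
      matrix_vector_mul_assoc matrix_mul_assoc algebra_simps)

text \<open>On the row-space part the Gram matrix cancels its inverse, and the gradient terms then
  cancel each other.\<close>

lemma Jg_mult_P_field:
  assumes "invertible (gram g x t)"
  shows "Jg g x t *v P_field f g \<alpha> x t = - time_deriv g x t"
proof -
  have "Jg g x t *v (transpose (Jg g x t) *v normal_coeff f g \<alpha> x t) =
      time_deriv g x t - (1 / \<alpha>) *\<^sub>R (Jg g x t *v gradient (\<lambda>y. f y t) x)"
    unfolding normal_coeff_def matrix_vector_mul_assoc
    by (simp add: matrix_mul_assoc matrix_inv_right[OF assms] flip: gram_def)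
  then show ?thesis
    by (simp add: P_field_eq matrix_vector_mult_diff_distrib matrix_vector_mult_scaleR
        linear_neg[OF matrix_vector_mul_linear])
qed

lemma P_ODE_solution_iff:
  "P_ODE_solution f g \<alpha> x J \<longleftrightarrow> (\<forall>t\<in>J. invertible (gram g (x t) t) \<and>
    (x has_vector_derivative P_field f g \<alpha> (x t) t) (at t within J))"
  by (simp add: P_ODE_solution_def P_field_def)

lemma P_ODE_solution_subset:
  assumes "P_ODE_solution f g \<alpha> x J" "J' \<subseteq> J"
  shows "P_ODE_solution f g \<alpha> x J'"
  using assms has_vector_derivative_within_subset unfolding P_ODE_solution_def by blast

lemma P_ODE_solution_continuous:
  assumes "P_ODE_solution f g \<alpha> x J"
  shows "continuous_on J x"
  unfolding continuous_on_eq_continuous_within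
proof
  fix t assume "t \<in> J"
  with assms have "(x has_vector_derivative P_field f g \<alpha> (x t) t) (at t within J)"
    by (simp add: P_ODE_solution_iff)
  then show "continuous (at t within J) x"
    by (rule has_vector_derivative_continuous)
qed

section \<open>Regularity, feasibility, uniqueness and existence on compact intervals\<close>

context
  fixes f :: "real^'n \<Rightarrow> real \<Rightarrow> real" and g :: "real^'n \<Rightarrow> real \<Rightarrow> real^'m" and \<alpha> :: real
  assumes A1: "assumption_A1 f g"
begin

lemma g_component_C2: "C2_in_x (\<lambda>x t. g x t $ k)"
  using A1 by (simp add: assumption_A1_def)

lemma g_has_derivative_x:
  assumes "0 \<le> t"
  shows "((\<lambda>y. g y t) has_derivative (\<lambda>h. Jg g x t *v h)) (at x)"
  using g_component_C2 assms by (intro Jg_works) (simp add: C2_in_x_def)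

lemma Jg_nth:
  assumes "0 \<le> t"
  shows "Jg g x t $ k = gradient (\<lambda>y. g y t $ k) x"
  using g_component_C2 assms by (intro Jg_row) (simp add: C2_in_x_def)

lemma g_component_differentiable_t:
  assumes "0 \<le> t"
  shows "(\<lambda>s. g x s $ k) differentiable (at t within {0..})"
  using A1 assms by (simp add: assumption_A1_def C2_in_t_def C1_in_t_def)

lemma continuous_on_Jg: "continuous_on (UNIV \<times> {0..}) (\<lambda>(x, t). Jg g x t)"
proof -
  have "continuous_on (UNIV \<times> {0..}) (\<lambda>p. \<chi> k. gradient (\<lambda>y. g y (snd p) $ k) (fst p))"
    using g_component_C2
    by (intro continuous_on_vec_lambda) (simp add: C2_in_x_def case_prod_unfold)
  also have "?this \<longleftrightarrow> ?thesis"
    by (rule continuous_on_cong) (auto simp: Jg_nth vec_eq_iff[where x = "vec_lambda _"])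
  finally show ?thesis .
qed

lemma continuous_on_time_deriv: "continuous_on (UNIV \<times> {0..}) (\<lambda>(x, t). time_deriv g x t)"
proof -
  have "continuous_on (UNIV \<times> {0..})
      (\<lambda>p. \<chi> k. time_deriv (\<lambda>x t. g x t $ k) (fst p) (snd p))"
    using A1
    by (intro continuous_on_vec_lambda)
      (simp add: assumption_A1_def C2_in_t_def C1_in_t_def case_prod_unfold)
  also have "?this \<longleftrightarrow> ?thesis"
    by (rule continuous_on_cong)
      (auto simp: time_deriv_component[OF g_component_differentiable_t] vec_eq_iff)
  finally show ?thesis .
qed

lemma continuous_on_gradient: "continuous_on (UNIV \<times> {0..}) (\<lambda>(x, t). gradient (\<lambda>y. f y t) x)"
  using A1 by (simp add: assumption_A1_def C2_in_x_def)

lemma continuous_on_gram: "continuous_on (UNIV \<times> {0..}) (\<lambda>(x, t). gram g x t)"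
  using continuous_on_Jg unfolding gram_def case_prod_unfold
  by (intro continuous_on_matrix_mult continuous_on_transpose)

text \<open>Partial derivatives combine to a joint one once one of them is jointly continuous; here
  it is the time derivative, packaged as a bounded linear function so that its continuity can be
  expressed.\<close>

lemma g_has_derivative:
  assumes "0 \<le> t"
  shows "((\<lambda>(x, t). g x t) has_derivative (\<lambda>(h, s). Jg g x t *v h + s *\<^sub>R time_deriv g x t))
    (at (x, t) within UNIV \<times> {0..})"
proof -
  have "((\<lambda>(x, t). g x t) has_derivative
      (\<lambda>(h, s). Jg g x t *v h + blinfun_scaleR_left (time_deriv g x t) s))
      (at (x, t) within UNIV \<times> {0..})"
  proof (rule has_derivative_partialsI)
    show "((\<lambda>y. g y t) has_derivative (\<lambda>h. Jg g x t *v h)) (at x)"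
      using assms by (rule g_has_derivative_x)
    show "(g y has_derivative blinfun_apply (blinfun_scaleR_left (time_deriv g y s)))
        (at s within {0..})" if "s \<in> {0..}" for y s
      using time_deriv_works[OF g_component_differentiable_t] that
      by (simp add: has_vector_derivative_def)
    have "continuous_on (UNIV \<times> {0..}) (\<lambda>(x, t). blinfun_scaleR_left (time_deriv g x t))"
      using continuous_on_time_deriv unfolding case_prod_unfold
      by (intro bounded_linear.continuous_on[OF bounded_linear_blinfun_scaleR_left])
    then show "continuous (at (x, t) within UNIV \<times> {0..})
        (\<lambda>(x, t). blinfun_scaleR_left (time_deriv g x t))"
      using assms by (simp add: continuous_on_eq_continuous_within)
  qed (use assms in auto)
  then show ?thesis by simp
qed

lemma continuous_on_g: "continuous_on (UNIV \<times> {0..}) (\<lambda>(x, t). g x t)"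
  unfolding continuous_on_eq_continuous_within
  using g_has_derivative has_derivative_continuous by fast

lemma continuous_on_normal_coeff:
  assumes "S \<subseteq> UNIV \<times> {0..}" and "\<And>x t. (x, t) \<in> S \<Longrightarrow> invertible (gram g x t)"
  shows "continuous_on S (\<lambda>(x, t). normal_coeff f g \<alpha> x t)"
proof -
  note [continuous_intros] = continuous_on_matrix_inv_mult continuous_on_matrix_vector_mult
    continuous_on_Jg[unfolded case_prod_unfold, THEN continuous_on_subset, OF assms(1)]
    continuous_on_gram[unfolded case_prod_unfold, THEN continuous_on_subset, OF assms(1)]
    continuous_on_gradient[unfolded case_prod_unfold, THEN continuous_on_subset, OF assms(1)]
    continuous_on_time_deriv[unfolded case_prod_unfold, THEN continuous_on_subset, OF assms(1)]
  show ?thesis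
    unfolding normal_coeff_def case_prod_unfold
    by (intro continuous_intros) (use assms(2) in auto)
qed

lemma continuous_on_P_field:
  assumes "S \<subseteq> UNIV \<times> {0..}" and "\<And>x t. (x, t) \<in> S \<Longrightarrow> invertible (gram g x t)"
  shows "continuous_on S (\<lambda>(x, t). P_field f g \<alpha> x t)"
proof -
  note [continuous_intros] = continuous_on_matrix_vector_mult continuous_on_transpose
    continuous_on_normal_coeff[OF assms, unfolded case_prod_unfold]
    continuous_on_Jg[unfolded case_prod_unfold, THEN continuous_on_subset, OF assms(1)]
    continuous_on_gradient[unfolded case_prod_unfold, THEN continuous_on_subset, OF assms(1)]
  show ?thesis
    unfolding P_field_eq case_prod_unfold by (intro continuous_intros)
qed

text \<open>By the chain rule the constraint value has derivative \<open>Jg\<close> times the field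
  plus \<open>time_deriv g\<close>, which vanishes. Invertibility of the Gram matrix along the curve
  is part of being a solution; this avoids a circle, since (A3) speaks of feasible points
  only.\<close>

lemma P_ODE_solution_feasible:
  assumes sol: "P_ODE_solution f g \<alpha> x {a..b}" and "0 \<le> a" and "g (x a) a = 0"
    and t: "t \<in> {a..b}"
  shows "g (x t) t = 0"
proof -
  have der: "((\<lambda>s. g (x s) s) has_derivative (\<lambda>h. 0)) (at s within {a..b})"
    if s: "s \<in> {a..b}" for s
  proof -
    let ?v = "P_field f g \<alpha> (x s) s"
    have inv: "invertible (gram g (x s) s)"
      and x': "(x has_derivative (\<lambda>h. h *\<^sub>R ?v)) (at s within {a..b})"
      using sol s by (auto simp: P_ODE_solution_iff has_vector_derivative_def)
    have "((\<lambda>(x, t). g x t) has_derivative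
        (\<lambda>(h, r). Jg g (x s) s *v h + r *\<^sub>R time_deriv g (x s) s))
        (at (x s, s) within (\<lambda>s. (x s, s)) ` {a..b})"
      by (rule has_derivative_subset[OF g_has_derivative]) (use s \<open>0 \<le> a\<close> in auto)
    moreover have "((\<lambda>s. (x s, s)) has_derivative (\<lambda>h. (h *\<^sub>R ?v, h))) (at s within {a..b})"
      by (intro has_derivative_Pair x' has_derivative_ident)
    ultimately have "((\<lambda>s. g (x s) s) has_derivative
        (\<lambda>h. Jg g (x s) s *v (h *\<^sub>R ?v) + h *\<^sub>R time_deriv g (x s) s)) (at s within {a..b})"
      using has_derivative_in_compose by fastforce
    then show ?thesis
      by (simp add: matrix_vector_mult_scaleR Jg_mult_P_field[OF inv])
  qed
  show ?thesis
  proof (rule has_derivative_zero_unique_strong_interval[of "{}" a b "\<lambda>s. g (x s) s"])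
    show "continuous_on {a..b} (\<lambda>s. g (x s) s)"
      using der has_derivative_continuous unfolding continuous_on_eq_continuous_within by blast
  qed (use der assms in auto)
qed

text \<open>Between two zeros at the same time, the Taylor expansion of each component reduces to
  its linear term and a quadratic remainder. The constants add up through the l1 norm.\<close>

lemma Jg_mult_quadratic_bound:
  assumes "0 \<le> a"
  obtains L where "L \<ge> 0"
    and "\<And>x y t. \<lbrakk>x \<in> cball 0 R; y \<in> cball 0 R; t \<in> {a..b}; g x t = 0; g y t = 0\<rbrakk> \<Longrightarrow>
      norm (Jg g x t *v (x - y)) \<le> L * (norm (x - y))\<^sup>2"
proof -
  have "\<exists>L. L \<ge> 0 \<and> (\<forall>x\<in>cball 0 R. \<forall>y\<in>cball 0 R. \<forall>t\<in>{a..b}.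
      \<bar>g y t $ k - g x t $ k - (y - x) \<bullet> gradient (\<lambda>z. g z t $ k) x\<bar> \<le> L * (norm (y - x))\<^sup>2)" for k
    using C2_Taylor_bound[OF g_component_C2[of k] assms, of R b] by metis
  then obtain L where L0: "\<And>k. L k \<ge> 0"
    and L: "\<And>k x y t. \<lbrakk>x \<in> cball 0 R; y \<in> cball 0 R; t \<in> {a..b}\<rbrakk> \<Longrightarrow>
      \<bar>g y t $ k - g x t $ k - (y - x) \<bullet> gradient (\<lambda>z. g z t $ k) x\<bar> \<le> L k * (norm (y - x))\<^sup>2"
    by metis
  show thesis
  proof (rule that)
    show "(\<Sum>k\<in>UNIV. L k) \<ge> 0"
      by (simp add: L0 sum_nonneg)
    fix x y t
    assume *: "x \<in> cball 0 R" "y \<in> cball 0 R" "t \<in> {a..b}" "g x t = 0" "g y t = 0"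
    have "\<bar>(Jg g x t *v (x - y)) $ k\<bar> \<le> L k * (norm (x - y))\<^sup>2" for k
    proof -
      have "(Jg g x t *v (x - y)) $ k = - ((y - x) \<bullet> gradient (\<lambda>z. g z t $ k) x)"
        using Jg_nth[of t x k] * assms
        by (simp add: matrix_vector_mul_component inner_commute inner_diff_left)
      then show ?thesis
        using L[OF *(1-3), of k] * by (simp add: norm_minus_commute)
    qed
    then have "(\<Sum>k\<in>UNIV. \<bar>(Jg g x t *v (x - y)) $ k\<bar>) \<le> (\<Sum>k\<in>UNIV. L k * (norm (x - y))\<^sup>2)"
      by (intro sum_mono)
    then show "norm (Jg g x t *v (x - y)) \<le> (\<Sum>k\<in>UNIV. L k) * (norm (x - y))\<^sup>2"
      using norm_le_l1_cart[of "Jg g x t *v (x - y)"] by (simp add: sum_distrib_right)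
  qed
qed

text \<open>
  Only continuity of \<open>time_deriv g\<close> is available, so the field need not be Lipschitz in \<open>x\<close>. But
  its irregular part is normal to the constraint manifold, and the difference of two feasible
  points is tangent up to second order; hence the field is one-sidedly Lipschitz along feasible
  pairs.
\<close>

lemma P_ODE_solution_unique:
  assumes "\<alpha> > 0" and "0 \<le> a"
    and x: "P_ODE_solution f g \<alpha> x {a..b}" and y: "P_ODE_solution f g \<alpha> y {a..b}"
    and init: "x a = y a" "g (x a) a = 0" and t: "t \<in> {a..b}"
  shows "x t = y t"
proof -
  have cont: "continuous_on {a..b} x" "continuous_on {a..b} y"
    by (fact P_ODE_solution_continuous[OF x], fact P_ODE_solution_continuous[OF y])
  have feas: "g (x s) s = 0" "g (y s) s = 0" if "s \<in> {a..b}" for s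
  proof -
    show "g (x s) s = 0"
      by (rule P_ODE_solution_feasible[OF x \<open>0 \<le> a\<close> init(2) that])
    show "g (y s) s = 0"
      by (rule P_ODE_solution_feasible[OF y \<open>0 \<le> a\<close> init(2)[unfolded init(1)] that])
  qed
  have "bounded (x ` {a..b} \<union> y ` {a..b})"
    using cont by (intro compact_imp_bounded compact_Un compact_continuous_image) auto
  then obtain R where "\<forall>z \<in> x ` {a..b} \<union> y ` {a..b}. norm z \<le> R"
    unfolding bounded_iff by blast
  then have R: "x s \<in> cball 0 R \<and> y s \<in> cball 0 R" if "s \<in> {a..b}" for s
    using that by simp
  have "continuous_on {a..b} (\<lambda>s. normal_coeff f g \<alpha> (z s) s)"
    if "P_ODE_solution f g \<alpha> z {a..b}" for z
  proof -
    have "continuous_on ((\<lambda>s. (z s, s)) ` {a..b}) (\<lambda>(x, t). normal_coeff f g \<alpha> x t)"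
      using that \<open>0 \<le> a\<close>
      by (intro continuous_on_normal_coeff) (auto simp: P_ODE_solution_def)
    moreover have "continuous_on {a..b} (\<lambda>s. (z s, s))"
      by (intro continuous_intros P_ODE_solution_continuous[OF that])
    ultimately have "continuous_on {a..b} (\<lambda>s. (\<lambda>(x, t). normal_coeff f g \<alpha> x t) (z s, s))"
      by (rule continuous_on_compose2) simp
    then show ?thesis by simp
  qed
  \<comment> \<open>Each curve keeps the Gram matrix invertible over a compact time interval, so
    continuity bounds the coefficient along it.\<close>
  then have "bounded ((\<lambda>s. normal_coeff f g \<alpha> (x s) s) ` {a..b} \<union>
      (\<lambda>s. normal_coeff f g \<alpha> (y s) s) ` {a..b})"
    using x y by (intro compact_imp_bounded compact_Un compact_continuous_image) auto
  then obtain V where "\<forall>z \<in> (\<lambda>s. normal_coeff f g \<alpha> (x s) s) ` {a..b} \<union>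
      (\<lambda>s. normal_coeff f g \<alpha> (y s) s) ` {a..b}. norm z \<le> V"
    unfolding bounded_iff by blast
  then have V: "norm (normal_coeff f g \<alpha> (x s) s) \<le> V \<and>
      norm (normal_coeff f g \<alpha> (y s) s) \<le> V" if "s \<in> {a..b}" for s
    using that by simp
  obtain L where "L \<ge> 0" and L: "\<And>x y t. \<lbrakk>x \<in> cball 0 R; y \<in> cball 0 R; t \<in> {a..b}\<rbrakk> \<Longrightarrow>
      norm (gradient (\<lambda>z. f z t) x - gradient (\<lambda>z. f z t) y) \<le> L * norm (x - y)"
    using C2_gradient_Lipschitz[of f a R b] A1 \<open>0 \<le> a\<close> by (auto simp: assumption_A1_def)
  obtain M where "M \<ge> 0" and M: "\<And>x y t.
      \<lbrakk>x \<in> cball 0 R; y \<in> cball 0 R; t \<in> {a..b}; g x t = 0; g y t = 0\<rbrakk> \<Longrightarrow>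
      norm (Jg g x t *v (x - y)) \<le> M * (norm (x - y))\<^sup>2"
    using Jg_mult_quadratic_bound[OF \<open>0 \<le> a\<close>, of R b] by blast
  define d where "d s = x s - y s" for s
  define v where "v s = P_field f g \<alpha> (x s) s - P_field f g \<alpha> (y s) s" for s
  \<comment> \<open>The outer 2 comes from differentiating \<open>d s \<bullet> d s\<close>; the
    gradients contribute \<open>L / \<alpha>\<close>, and each of the two row-space terms
    \<open>M * V\<close>.\<close>
  define C where "C = 2 * (L / \<alpha> + 2 * (M * V))"
  have d': "(d has_vector_derivative v s) (at s within {a..b})" if "s \<in> {a..b}" for s
    using x y that unfolding P_ODE_solution_iff d_def v_def
    by (auto intro: has_vector_derivative_diff)
  have "d t \<bullet> d t \<le> 0"
  proof (rule Gronwall_nonpos[where \<phi> = "\<lambda>s. d s \<bullet> d s" and C = C])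
    fix s assume s: "s \<in> {a..b}"
    show "((\<lambda>s. d s \<bullet> d s) has_vector_derivative 2 * (d s \<bullet> v s)) (at s within {a..b})"
      using has_derivative_inner[OF d'[OF s, unfolded has_vector_derivative_def]
          d'[OF s, unfolded has_vector_derivative_def]]
      unfolding has_vector_derivative_def
      by (simp add: inner_commute algebra_simps)
    let ?u = "\<lambda>z. gradient (\<lambda>y. f y s) (z s)"
    have normal: "\<bar>d s \<bullet> (transpose (Jg g (z s) s) *v normal_coeff f g \<alpha> (z s) s)\<bar>
        \<le> M * V * (d s \<bullet> d s)" if "z = x \<or> z = y" for z
    proof -
      have J: "norm (Jg g (z s) s *v d s) \<le> M * (norm (d s))\<^sup>2"
        using that
      proof
        assume "z = x"
        then show ?thesis using M[of "x s" "y s" s] R[OF s] s feas[OF s] by (simp add: d_def)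
      next
        assume "z = y"
        moreover have "Jg g (y s) s *v (x s - y s) = - (Jg g (y s) s *v (y s - x s))"
          by (simp add: matrix_vector_mult_diff_distrib)
        ultimately show ?thesis
          using M[of "y s" "x s" s] R[OF s] s feas[OF s] by (simp add: d_def norm_minus_commute)
      qed
      \<comment> \<open>With the transpose moved onto \<open>d s\<close>, each row-space term is
        small by itself; the difference of the two coefficients is never estimated.\<close>
      have "d s \<bullet> (transpose (Jg g (z s) s) *v normal_coeff f g \<alpha> (z s) s) =
          (Jg g (z s) s *v d s) \<bullet> normal_coeff f g \<alpha> (z s) s"
        by (metis dot_lmul_matrix inner_commute transpose_matrix_vector)
      also have "\<bar>\<dots>\<bar> \<le> norm (Jg g (z s) s *v d s) * norm (normal_coeff f g \<alpha> (z s) s)"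
        by (rule Cauchy_Schwarz_ineq2)
      also have "\<dots> \<le> (M * (norm (d s))\<^sup>2) * V"
        using J V[OF s] that \<open>M \<ge> 0\<close> by (intro mult_mono) auto
      finally show ?thesis
        by (simp add: power2_norm_eq_inner mult_ac)
    qed
    have "\<bar>d s \<bullet> (?u x - ?u y)\<bar> \<le> norm (d s) * norm (?u x - ?u y)"
      by (rule Cauchy_Schwarz_ineq2)
    also have "\<dots> \<le> norm (d s) * (L * norm (d s))"
      unfolding d_def using L R[OF s] s by (intro mult_left_mono) auto
    finally have "\<bar>d s \<bullet> (?u x - ?u y)\<bar> \<le> L * (d s \<bullet> d s)"
      by (simp add: dot_square_norm power2_eq_square mult_ac)
    then have grad: "- (1 / \<alpha>) * (d s \<bullet> (?u x - ?u y)) \<le> 1 / \<alpha> * (L * (d s \<bullet> d s))"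
      using \<open>\<alpha> > 0\<close> by (auto simp: divide_right_mono abs_le_iff field_simps)
    have "d s \<bullet> v s = - (1 / \<alpha>) * (d s \<bullet> (?u x - ?u y))
        - d s \<bullet> (transpose (Jg g (x s) s) *v normal_coeff f g \<alpha> (x s) s)
        + d s \<bullet> (transpose (Jg g (y s) s) *v normal_coeff f g \<alpha> (y s) s)"
      unfolding v_def P_field_eq by (simp add: inner_diff_right inner_add_right algebra_simps)
    also have "\<dots> \<le> 1 / \<alpha> * (L * (d s \<bullet> d s)) + M * V * (d s \<bullet> d s) + M * V * (d s \<bullet> d s)"
      using grad normal[of x, OF disjI1[OF refl]] normal[of y, OF disjI2[OF refl]] by linarith
    finally have "2 * (d s \<bullet> v s) \<le>
        2 * (1 / \<alpha> * (L * (d s \<bullet> d s)) + M * V * (d s \<bullet> d s) + M * V * (d s \<bullet> d s))"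
      by simp
    also have "\<dots> = C * (d s \<bullet> d s)"
      by (simp add: C_def algebra_simps)
    finally show "2 * (d s \<bullet> v s) \<le> C * (d s \<bullet> d s)" .
  qed (use init t in \<open>auto simp: d_def\<close>)
  then have "d t \<bullet> d t = 0"
    using inner_ge_zero[of "d t"] by linarith
  then show ?thesis
    by (simp add: d_def)
qed

text \<open>
  The field is cut off outside a compact neighbourhood of \<open>C\<close>. A solution of the modified equation
  solves the original one until it leaves that neighbourhood, but up to that time it is confined
  to \<open>C\<close>.
\<close>

lemma P_ODE_solution_exists:
  assumes "0 \<le> a" "a \<le> b" and "compact C" "C \<subseteq> UNIV \<times> {a..b}" and x0: "(x0, a) \<in> C"
    and inv: "\<And>x t. (x, t) \<in> C \<Longrightarrow> invertible (gram g x t)"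
    and confined: "\<And>x s. \<lbrakk>s \<in> {a..b}; P_ODE_solution f g \<alpha> x {a..s}; x a = x0\<rbrakk> \<Longrightarrow> (x s, s) \<in> C"
  obtains x where "P_ODE_solution f g \<alpha> x {a..b}" and "x a = x0"
proof -
  \<comment> \<open>A continuous margin of invertibility: above a positive level the Gram matrix
    cannot degenerate.\<close>
  define \<phi> where "\<phi> p = \<bar>det (gram g (fst p) (snd p))\<bar>" for p
  have sub: "(UNIV :: (real^'n) set) \<times> {a..b} \<subseteq> UNIV \<times> {0..}"
    using \<open>0 \<le> a\<close> by auto
  have \<phi>_cont: "continuous_on (UNIV \<times> {a..b}) \<phi>"
    unfolding \<phi>_def using continuous_on_subset[OF continuous_on_gram sub]
    by (intro continuous_on_rabs continuous_on_det) (simp add: case_prod_unfold)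
  obtain p0 where "p0 \<in> C" and p0: "\<And>p. p \<in> C \<Longrightarrow> \<phi> p0 \<le> \<phi> p"
    using continuous_attains_inf[OF \<open>compact C\<close>, of \<phi>] x0
      continuous_on_subset[OF \<phi>_cont \<open>C \<subseteq> _\<close>] by blast
  \<comment> \<open>Half the minimum over \<open>C\<close>, so that points of \<open>C\<close>
    satisfy the determinant condition of \<open>N\<close> strictly; the radius \<open>R + 1\<close>
    does the same for the norm.\<close>
  define m where "m = \<phi> p0 / 2"
  have "m > 0"
    using inv[of "fst p0" "snd p0"] \<open>p0 \<in> C\<close> by (simp add: m_def \<phi>_def invertible_det_nz)
  have "bounded (fst ` C)"
    using \<open>compact C\<close> by (intro bounded_fst compact_imp_bounded)
  then obtain R where R: "\<And>p. p \<in> C \<Longrightarrow> norm (fst p) \<le> R"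
    unfolding bounded_iff by auto
  define N where "N = (cball 0 (R + 1) \<times> {a..b}) \<inter> \<phi> -` {m..}"
  have N_sub: "N \<subseteq> UNIV \<times> {a..b}"
    by (auto simp: N_def)
  have N_inv: "invertible (gram g x t)" if "(x, t) \<in> N" for x t
    using that \<open>m > 0\<close> by (auto simp: N_def \<phi>_def invertible_det_nz)
  have "C \<subseteq> N"
    using R p0 \<open>C \<subseteq> _\<close> \<open>m > 0\<close> by (force simp: N_def m_def)
  have "closed N"
    unfolding N_def
    by (intro continuous_closed_preimage continuous_on_subset[OF \<phi>_cont] closed_Times) auto
  have "compact N"
  proof -
    have "N = (cball 0 (R + 1) \<times> {a..b}) \<inter> N" by (auto simp: N_def)
    moreover have "compact ((cball (0 :: real^'n) (R + 1) \<times> {a..b}) \<inter> N)"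
      by (intro compact_Int_closed compact_Times \<open>closed N\<close>) auto
    ultimately show ?thesis by simp
  qed
  define F where "F = (\<lambda>(x, t). P_field f g \<alpha> x t)"
  have F_cont: "continuous_on N F"
    unfolding F_def using N_sub sub N_inv by (intro continuous_on_P_field) auto
  then have "bounded (F ` N)"
    using \<open>compact N\<close> by (intro compact_imp_bounded compact_continuous_image)
  then obtain B where "B > 0" and B: "\<And>p. p \<in> N \<Longrightarrow> norm (F p) \<le> B"
    unfolding bounded_pos by auto
  \<comment> \<open>Tietze's extension keeps the bound \<open>B\<close>, which Peano's theorem
    requires for all states.\<close>
  obtain F' where F': "continuous_on (UNIV \<times> {a..b}) F'" "\<And>p. p \<in> N \<Longrightarrow> F' p = F p"
    "\<And>p. p \<in> UNIV \<times> {a..b} \<Longrightarrow> norm (F' p) \<le> B"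
    using Tietze[OF F_cont closed_subset[OF N_sub \<open>closed N\<close>] _ B] \<open>B > 0\<close> by auto
  obtain x where "x a = x0"
    and x': "\<And>t. t \<in> {a..b} \<Longrightarrow> (x has_vector_derivative F' (x t, t)) (at t within {a..b})"
    using Peano_existence[OF F'(1) _ \<open>a \<le> b\<close>, of B x0] F'(3) by auto
  have "continuous_on {a..b} x"
    unfolding continuous_on_eq_continuous_within using x' has_vector_derivative_continuous by blast
  then have x_cont: "continuous_on {a..b} (\<lambda>t. (x t, t))"
    by (intro continuous_intros)
  have sol: "P_ODE_solution f g \<alpha> x {a..s}" if "s \<in> {a..b}" "\<And>t. t \<in> {a..s} \<Longrightarrow> (x t, t) \<in> N" for s
    unfolding P_ODE_solution_iff
  proof (intro ballI conjI)
    fix t assume t: "t \<in> {a..s}"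
    show "invertible (gram g (x t) t)"
      using N_inv that(2)[OF t] .
    have "(x has_vector_derivative F' (x t, t)) (at t within {a..s})"
      by (rule has_vector_derivative_within_subset[OF x']) (use that t in auto)
    then show "(x has_vector_derivative P_field f g \<alpha> (x t) t) (at t within {a..s})"
      using F'(2)[OF that(2)[OF t]] by (simp add: F_def)
  qed
  have "(x t, t) \<in> N" if "t \<in> {a..b}" for t
  proof (rule ccontr)
    assume "(x t, t) \<notin> N"
    define E where "E = {s \<in> {a..b}. (x s, s) \<notin> N}"
    define \<tau> where "\<tau> = Inf E"
    have "E \<noteq> {}" and bdd: "bdd_below E"
      using \<open>(x t, t) \<notin> N\<close> that by (auto simp: E_def intro: bdd_belowI[of _ a])
    have \<tau>: "\<tau> \<in> {a..b}"
      using cInf_greatest[OF \<open>E \<noteq> {}\<close>, of a] cInf_lower[OF _ bdd] \<open>E \<noteq> {}\<close>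
      unfolding \<tau>_def E_def by force
    have before: "(x s, s) \<in> N" if "s \<in> {a..<\<tau>}" for s
    proof (rule ccontr)
      assume "(x s, s) \<notin> N"
      then have "s \<in> E"
        using that \<tau> by (simp add: E_def)
      then show False
        using cInf_lower[OF _ bdd] that unfolding \<tau>_def by fastforce
    qed
    \<comment> \<open>At the first exit time the graph is still in the closed set \<open>N\<close>,
      so \<open>x\<close> solves the original equation on all of \<open>{a..\<tau>}\<close>. The
      case \<open>\<tau> = a\<close> is separate because \<open>{a..<\<tau>}\<close> is then
      empty.\<close>
    have "(x \<tau>, \<tau>) \<in> N"
    proof (cases "\<tau> = a")
      case True
      then show ?thesis using \<open>x a = x0\<close> x0 \<open>C \<subseteq> N\<close> by auto
    next
      case False
      let ?V = "{a..b} \<inter> (\<lambda>t. (x t, t)) -` N"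
      have "closed ?V"
        by (intro continuous_closed_preimage x_cont \<open>closed N\<close>) auto
      moreover have "{a..<\<tau>} \<subseteq> ?V"
        using before \<tau> by auto
      ultimately have "closure {a..<\<tau>} \<subseteq> ?V"
        by (rule closure_minimal[rotated])
      then show ?thesis
        using False \<tau> by auto
    qed
    then have "(x s, s) \<in> N" if "s \<in> {a..\<tau>}" for s
      using before[of s] that by (cases "s = \<tau>") auto
    \<comment> \<open>Confinement improves \<open>N\<close> to \<open>C\<close>, where the
      inequalities are strict and persist beyond \<tau>, against its choice as an infimum.\<close>
    then have "(x \<tau>, \<tau>) \<in> C"
      using confined[OF \<tau> sol[OF \<tau>] \<open>x a = x0\<close>] by blast
    then have "m < \<phi> (x \<tau>, \<tau>)" "norm (x \<tau>) < R + 1"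
      using p0[of "(x \<tau>, \<tau>)"] R[of "(x \<tau>, \<tau>)"] \<open>m > 0\<close> by (auto simp: m_def)
    moreover have "continuous_on {a..b} (\<lambda>t. \<phi> (x t, t))"
      by (rule continuous_on_compose2[OF \<phi>_cont x_cont]) auto
    then have "((\<lambda>t. \<phi> (x t, t)) \<longlongrightarrow> \<phi> (x \<tau>, \<tau>)) (at \<tau> within {a..b})"
      using \<tau> by (simp add: continuous_on_def)
    moreover have "continuous_on {a..b} (\<lambda>t. norm (x t))"
      using \<open>continuous_on {a..b} x\<close> by (intro continuous_intros)
    then have "((\<lambda>t. norm (x t)) \<longlongrightarrow> norm (x \<tau>)) (at \<tau> within {a..b})"
      using \<tau> by (simp add: continuous_on_def)
    ultimately have "\<forall>\<^sub>F s in at \<tau> within {a..b}. m < \<phi> (x s, s) \<and> norm (x s) < R + 1"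
      by (intro eventually_conj) (auto dest: order_tendstoD)
    then obtain \<delta> where "\<delta> > 0" and \<delta>: "\<And>s. \<lbrakk>s \<in> {a..b}; s \<noteq> \<tau>; \<bar>s - \<tau>\<bar> < \<delta>\<rbrakk> \<Longrightarrow>
        m < \<phi> (x s, s) \<and> norm (x s) < R + 1"
      unfolding eventually_at dist_real_def by auto
    obtain s where "s \<in> E" "s < \<tau> + \<delta>"
      using cInf_lessD[OF \<open>E \<noteq> {}\<close>, of "\<tau> + \<delta>"] \<open>\<delta> > 0\<close> by (auto simp: \<tau>_def)
    moreover have "\<tau> \<le> s"
      using cInf_lower[OF \<open>s \<in> E\<close> bdd] by (simp add: \<tau>_def)
    moreover have "s \<noteq> \<tau>"
      using \<open>s \<in> E\<close> \<open>(x \<tau>, \<tau>) \<in> N\<close> by (auto simp: E_def)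
    ultimately show False
      using \<delta>[of s] by (auto simp: E_def N_def)
  qed
  then have "P_ODE_solution f g \<alpha> x {a..b}"
    using sol[of b] \<open>a \<le> b\<close> by auto
  then show thesis
    using \<open>x a = x0\<close> that by blast
qed

end

section \<open>From compact subintervals to the whole time interval\<close>

lemma time_interval_from_subinterval:
  assumes "time_interval_from t0 I" "T \<in> I"
  shows "{t0..T} \<subseteq> I"
  using assms unfolding time_interval_from_def is_interval_1 by (meson atLeastAtMost_iff subsetI)

theorem theorem1:
  fixes f :: "real^'n \<Rightarrow> real \<Rightarrow> real"
    and g :: "real^'n \<Rightarrow> real \<Rightarrow> real^'m"
    and \<alpha> t0 :: real
    and x0 :: "real^'n"
    and h :: "real \<Rightarrow> real^'n"
    and D :: "(real^'n) set"
    and I K :: "real set"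
  assumes "assumption_A1 f g"
    and "assumption_A2 g"
    and "assumption_A3 g"
    and "assumption_A4 f g"
    and "\<alpha> > 0"
    and "time_interval_from t0 I"
    and "x0 \<in> feasible_set g t0"
    and "local_min_trajectory f g h K" and "I \<subseteq> K"
    and "compact D" and "x0 - h t0 \<in> D"
    and "\<And>x J. \<lbrakk>time_interval_from t0 J; P_ODE_solution f g \<alpha> x J; x t0 = x0\<rbrakk>
           \<Longrightarrow> \<forall>t \<in> J \<inter> I. x t - h t \<in> D"
  shows "\<exists>x. P_ODE_solution f g \<alpha> x I \<and> x t0 = x0 \<and>
           (\<forall>y. P_ODE_solution f g \<alpha> y I \<and> y t0 = x0 \<longrightarrow> (\<forall>t\<in>I. y t = x t))"
proof -
  note A1 = assms(1)
  have "0 \<le> t0" and "t0 \<in> I" and ge: "\<And>t. t \<in> I \<Longrightarrow> t0 \<le> t"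
    using \<open>time_interval_from t0 I\<close> by (auto simp: time_interval_from_def)
  have sub: "{t0..T} \<subseteq> I" if "T \<in> I" for T
    using time_interval_from_subinterval[OF \<open>time_interval_from t0 I\<close> that] .
  have "g x0 t0 = 0"
    using \<open>x0 \<in> feasible_set g t0\<close> by (simp add: feasible_set_def)
  have "continuous_on I h"
    using \<open>local_min_trajectory f g h K\<close> \<open>I \<subseteq> K\<close>
    by (auto simp: local_min_trajectory_def intro: continuous_on_subset)
  have "\<exists>x. P_ODE_solution f g \<alpha> x {t0..T} \<and> x t0 = x0" if T: "T \<in> I" for T
  proof -
    \<comment> \<open>The moving tube \<open>h + D\<close> is a continuous image of
      \<open>D \<times> {t0..T}\<close>, hence compact; intersecting it with the zero set of
      \<open>g\<close> makes (A3) available at all its points.\<close>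
    define C where "C = (\<lambda>(d, t). (d + h t, t)) ` (D \<times> {t0..T}) \<inter>
      ((UNIV \<times> {0..}) \<inter> (\<lambda>(x, t). g x t) -` {0})"
    have C_iff: "(x, t) \<in> C \<longleftrightarrow> t \<in> {t0..T} \<and> x - h t \<in> D \<and> g x t = 0" for x t
      using \<open>0 \<le> t0\<close> by (force simp: C_def image_iff)
    have "compact C"
      unfolding C_def
    proof (intro compact_Int_closed compact_continuous_image compact_Times \<open>compact D\<close>
        continuous_closed_preimage continuous_on_g[OF A1])
      show "continuous_on (D \<times> {t0..T}) (\<lambda>(d, t). (d + h t, t))"
        unfolding case_prod_unfold
        by (intro continuous_intros continuous_on_compose2[OF \<open>continuous_on I h\<close>])
          (use sub[OF T] in auto)
    qed (auto intro: closed_Times)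
    obtain x where "P_ODE_solution f g \<alpha> x {t0..T}" "x t0 = x0"
    proof (rule P_ODE_solution_exists[OF A1 \<open>0 \<le> t0\<close> ge[OF T] \<open>compact C\<close>])
      show "(x0, t0) \<in> C"
        using \<open>g x0 t0 = 0\<close> \<open>x0 - h t0 \<in> D\<close> ge[OF T] by (simp add: C_iff)
      show "invertible (gram g x t)" if "(x, t) \<in> C" for x t
        using that \<open>assumption_A3 g\<close> \<open>0 \<le> t0\<close>
        by (intro full_rank_gram_invertible) (auto simp: C_iff assumption_A3_def feasible_set_def)
      show "(x s, s) \<in> C"
        if s: "s \<in> {t0..T}" and x: "P_ODE_solution f g \<alpha> x {t0..s}" "x t0 = x0" for x s
      proof -
        \<comment> \<open>The hypothesis is invoked on the truncated interval, since nothing is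
          known yet about a continuation past \<open>s\<close>.\<close>
        have "time_interval_from t0 {t0..s}"
          using s \<open>0 \<le> t0\<close> by (auto simp: time_interval_from_def is_interval_cc)
        then have "x s - h s \<in> D"
          using assms(12)[OF _ x] s sub[OF T] by auto
        moreover have "g (x s) s = 0"
          using P_ODE_solution_feasible[OF A1 x(1) \<open>0 \<le> t0\<close>] x(2) \<open>g x0 t0 = 0\<close> s by auto
        ultimately show ?thesis
          using s by (simp add: C_iff)
      qed
    qed (auto simp: C_iff)
    then show ?thesis by blast
  qed
  then obtain X where X: "\<And>T. T \<in> I \<Longrightarrow> P_ODE_solution f g \<alpha> (X T) {t0..T}"
    and X0: "\<And>T. T \<in> I \<Longrightarrow> X T t0 = x0"
    by metis
  \<comment> \<open>Comparing at time \<open>t\<close> with \<open>X t\<close>, restricted to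
    \<open>{t0..t}\<close>, gives a value independent of \<open>T\<close>; the diagonal
    \<open>X t t\<close> is therefore the glued solution.\<close>
  have unique: "y t = X t t"
    if "P_ODE_solution f g \<alpha> y {t0..T}" "y t0 = x0" "T \<in> I" "t \<in> {t0..T}" for y t T
  proof (rule P_ODE_solution_unique[OF A1 \<open>\<alpha> > 0\<close> \<open>0 \<le> t0\<close>, where y = "X t" and b = t])
    show "P_ODE_solution f g \<alpha> y {t0..t}"
      using that by (auto intro: P_ODE_solution_subset)
    have "t \<in> I" using sub that by blast
    then show "P_ODE_solution f g \<alpha> (X t) {t0..t}" "y t0 = X t t0"
      using X X0 that by auto
  qed (use that \<open>g x0 t0 = 0\<close> in auto)
  define x where "x t = X t t" for t
  have x_eq: "x s = X T s" if "T \<in> I" "s \<in> {t0..T}" for s T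
    using unique[OF X X0] that by (simp add: x_def)
  have deriv: "(x has_vector_derivative P_field f g \<alpha> (x t) t) (at t within {t0..T})"
    if "T \<in> I" "t \<in> {t0..T}" for t T
  proof -
    have "(X T has_vector_derivative P_field f g \<alpha> (x t) t) (at t within {t0..T})"
      using X[OF that(1)] that by (simp add: P_ODE_solution_iff x_eq)
    then show ?thesis
      by (rule has_vector_derivative_transform[OF that(2), rotated]) (simp add: x_eq that)
  qed
  have "P_ODE_solution f g \<alpha> x I"
    unfolding P_ODE_solution_iff
  proof (intro ballI conjI)
    fix t assume t: "t \<in> I"
    then show "invertible (gram g (x t) t)"
      using X[OF t] ge by (auto simp: P_ODE_solution_iff x_def)
    \<comment> \<open>If \<open>I\<close> continues beyond \<open>t\<close>, then
      \<open>{t0..T}\<close> and \<open>I\<close> agree near \<open>t\<close> for some later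
      \<open>T\<close>; otherwise \<open>I\<close> is \<open>{t0..t}\<close> itself.\<close>
    obtain T where "T \<in> I" "t \<in> {t0..T}" "at t within {t0..T} = at t within I"
    proof (cases "\<exists>T\<in>I. t < T")
      case True
      then obtain T where "T \<in> I" "t < T" by blast
      moreover have "at t within {t0..T} = at t within I"
        by (rule at_within_nhd[of _ "{..<T}"]) (use \<open>t < T\<close> sub[OF \<open>T \<in> I\<close>] ge in auto)
      ultimately show ?thesis using that ge[OF t] by auto
    next
      case False
      then have "I = {t0..t}"
        using sub[OF t] ge by (auto simp: not_less)
      then have "at t within {t0..t} = at t within I" by simp
      with t ge[OF t] show ?thesis by (intro that[of t]) auto
    qed
    then show "(x has_vector_derivative P_field f g \<alpha> (x t) t) (at t within I)"
      using deriv by metis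
  qed
  moreover have "x t0 = x0"
    using X0[OF \<open>t0 \<in> I\<close>] by (simp add: x_def)
  moreover have "y t = x t" if "P_ODE_solution f g \<alpha> y I" "y t0 = x0" "t \<in> I" for y t
    using unique[OF P_ODE_solution_subset[OF that(1) sub[OF \<open>t \<in> I\<close>]] that(2,3)] ge[OF that(3)]
    by (simp add: x_def)
  ultimately show ?thesis
    by blast
qed

end
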